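(* Let $n\geq 3$ be an integer and let $W$ be a $2$-basic landmark system for the generalized Hamming graph $HG(n,n,n;3)$. Then $W$ is a resolving set for $HG(n,n,n;3)$ if and only if the edge-colored landmark graph $\mathcal{G}(W)$ contains neither of the following subgraphs: (1) a $4$-cycle that contains all three colors of edges; (2) a $6$-cycle with opposite edges of the same color (that is, each of its three pairs of opposite edges consists of two edges of the same color).
   Context: Write $[n]=\{1,2,\ldots,n\}$. The generalized Hamming graph $HG(n,n,n;3)$ is the simple graph with vertex set $[n]^3$ in which two vertices $(x_1,x_2,x_3)$ and $(y_1,y_2,y_3)$ are adjacent if and only if $x_i\neq y_i$ for $i=1,2,3$. For $n\geq 3$ it is connected. For a finite connected graph $G$ with vertex set $V$ and graph distance $d$, a subset $W\subseteq V$ is a resolving set for $G$ if for every pair of distinct vertices $x,y\in V-W$ there exists $w\in W$ such that $d(x,w)\neq d(y,w)$. For $W\subseteq [n]^3$, $1\leq i\leq 3$ and $a\in[n]$, let $W_{i,a}=\{(x_1,x_2,x_3)\in W\mid x_i=a\}$. The landmark graph $\mathcal{G}(W)$ is the edge-colored hypergraph with vertex set $W$ whose hyperedges are the nonempty sets $W_{i,a}$, with $W_{i,a}$ assigned color $i\in\{1,2,3\}$. A set $W\subseteq[n]^3$ is a $2$-basic landmark system for $HG(n,n,n;3)$ if (i) $|W_{i,a}|=2$ for all $1\leq i\leq 3$ and $a\in[n]$; and (ii) $|W_{i,a}\cap W_{j,b}|\leq 1$ for all $1\leq i<j\leq 3$ and $a,b\in[n]$. In this case $\mathcal{G}(W)$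 is a simple $3$-regular graph, properly edge-colored with three colors, with $n$ edges of each color. Subgraphs are not required to be induced. *)

theory Defs
  imports "HOL-Analysis.Finite_Cartesian_Product" "HOL-Library.Extended_Nat"
begin

text \<open>
  A graph is given by its vertex set and its symmetric adjacency relation. \<open>(x, y) \<in> E ^^ k\<close>
  says that there is a walk with \<open>k\<close> edges from \<open>x\<close> to \<open>y\<close>; the distance
  is \<open>\<infinity>\<close> if there is no walk at all.
\<close>

definition graph_dist :: "'v rel \<Rightarrow> 'v \<Rightarrow> 'v \<Rightarrow> enat" where
  "graph_dist E x y = (INF k \<in> {k. (x, y) \<in> E ^^ k}. enat k)"

definition resolving_set :: "'v set \<Rightarrow> 'v rel \<Rightarrow> 'v set \<Rightarrow> bool" where
  "resolving_set V E W \<longleftrightarrow> W \<subseteq> V \<and>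
     (\<forall>x \<in> V - W. \<forall>y \<in> V - W. x \<noteq> y \<longrightarrow>
        (\<exists>w \<in> W. graph_dist E x w \<noteq> graph_dist E y w))"

text \<open>
  Coordinate positions and colors are elements of the three-element type \<open>3\<close>,
  whose elements are \<open>1\<close>, \<open>2\<close> and \<open>3\<close> (with \<open>3 = 0\<close>).
\<close>

definition HG_verts :: "nat \<Rightarrow> (nat ^ 3) set" where
  "HG_verts n = {x. \<forall>i. x $ i \<in> {1..n}}"

definition HG_adj :: "nat \<Rightarrow> (nat ^ 3) rel" where
  "HG_adj n = {(x, y). x \<in> HG_verts n \<and> y \<in> HG_verts n \<and> (\<forall>i. x $ i \<noteq> y $ i)}"

definition slice :: "(nat ^ 3) set \<Rightarrow> 3 \<Rightarrow> nat \<Rightarrow> (nat ^ 3) set" where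
  "slice W i a = {x \<in> W. x $ i = a}"

definition two_basic_landmark_system :: "nat \<Rightarrow> (nat ^ 3) set \<Rightarrow> bool" where
  "two_basic_landmark_system n W \<longleftrightarrow> W \<subseteq> HG_verts n \<and>
     (\<forall>i. \<forall>a \<in> {1..n}. card (slice W i a) = 2) \<and>
     (\<forall>i j. i \<noteq> j \<longrightarrow>
        (\<forall>a \<in> {1..n}. \<forall>b \<in> {1..n}. card (slice W i a \<inter> slice W j b) \<le> 1))"

text \<open>
  A hyperedge is stored together with its color, so that equal vertex sets
  occurring with different colors remain different hyperedges.
\<close>

record ('v, 'c) colored_hypergraph =
  hverts :: "'v set"
  hedges :: "('c \<times> 'v set) set"

definition landmark_graph :: "nat \<Rightarrow> (nat ^ 3) set \<Rightarrow> (nat ^ 3, 3) colored_hypergraph" where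
  "landmark_graph n W =
     \<lparr>hverts = W,
      hedges = {(i, slice W i a) | i a. a \<in> {1..n} \<and> slice W i a \<noteq> {}}\<rparr>"

text \<open>
  \<open>vs\<close> lists the vertices of a (not necessarily induced) cycle in cyclic order;
  \<open>cs ! k\<close> is the color of the edge from \<open>vs ! k\<close> to its cyclic successor.
\<close>

definition colored_cycle ::
    "('v, 'c) colored_hypergraph \<Rightarrow> 'v list \<Rightarrow> 'c list \<Rightarrow> bool" where
  "colored_cycle G vs cs \<longleftrightarrow>
     length vs \<ge> 3 \<and> length cs = length vs \<and> distinct vs \<and> set vs \<subseteq> hverts G \<and>
     (\<forall>k < length vs. (cs ! k, {vs ! k, vs ! (Suc k mod length vs)}) \<in> hedges G)"

definition has_three_colored_4_cycle :: "('v, 3) colored_hypergraph \<Rightarrow> bool" where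
  "has_three_colored_4_cycle G \<longleftrightarrow>
     (\<exists>vs cs. colored_cycle G vs cs \<and> length vs = 4 \<and> set cs = {1, 2, 3})"

definition has_opposite_colored_6_cycle :: "('v, 'c) colored_hypergraph \<Rightarrow> bool" where
  "has_opposite_colored_6_cycle G \<longleftrightarrow>
     (\<exists>vs cs. colored_cycle G vs cs \<and> length vs = 6 \<and> (\<forall>k < 3. cs ! k = cs ! (k + 3)))"

end

theory Submission
  imports Defs "HOL-Analysis.Cartesian_Space"
begin

text \<open>
  Since \<open>n \<ge> 3\<close>, the graph has diameter two, so a landmark \<open>w \<noteq> x\<close> only reports whether it shares a
  coordinate with \<open>x\<close>. Hence \<open>W\<close> is resolving iff a vertex \<open>x \<notin> W\<close> is determined by its \<^emph>\<open>trace\<close>, the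
  set of landmarks sharing a coordinate with it (\<open>resolving_set_iff_trace_inj\<close>). A vertex of the
  Hamming graph is the same thing as a choice of one edge of each color in the landmark graph; its
  trace is the union of the three edges, and it lies in \<open>W\<close> iff the three edges meet in a common
  vertex. The question becomes when two different edge triples, neither of them a star, cover the
  same landmarks.

  A forbidden cycle supplies such a pair: in a 4-cycle colored \<open>i, j, i, k\<close> both \<open>i\<close>-edges complete
  the \<open>j\<close>-edge and the \<open>k\<close>-edge to a cover of the cycle, and a 6-cycle colored \<open>i, j, k, i, j, k\<close> is
  covered by each of its two sets of alternating edges.

  Conversely, let two triples have the same union. Edges of one color are disjoint, and edges of
  different colors share at most one vertex; so an edge of the first triple that is not in the second
  has exactly one end on each of the second triple's edges of the other two colors
  (\<open>edge_splits\<close>). If the triples differ in one color, the two edges of that color are thereby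
  joined to a 4-cycle by the two common edges. If they differ in two colors, the common edge would have
  an end at which one of the triples is a star. If they differ in all three colors, the six edges
  alternate around a 6-cycle.
\<close>

section \<open>Distances and traces\<close>

lemma graph_dist_eq_1:
  assumes "x \<noteq> y" "(x, y) \<in> E"
  shows "graph_dist E x y = 1"
  unfolding graph_dist_def
proof (rule antisym)
  have "(INF k\<in>{k. (x, y) \<in> E ^^ k}. enat k) \<le> enat 1"
    by (rule INF_lower) (use assms in simp)
  then show "(INF k\<in>{k. (x, y) \<in> E ^^ k}. enat k) \<le> 1" by (simp add: one_enat_def)
  have "1 \<le> k" if "(x, y) \<in> E ^^ k" for k
    using that assms(1) by (cases k) auto
  then show "1 \<le> (INF k\<in>{k. (x, y) \<in> E ^^ k}. enat k)"
    by (intro INF_greatest) (auto simp: one_enat_def)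
qed

lemma graph_dist_eq_2:
  assumes "x \<noteq> y" "(x, y) \<notin> E" "(x, z) \<in> E" "(z, y) \<in> E"
  shows "graph_dist E x y = 2"
  unfolding graph_dist_def
proof (rule antisym)
  have "(x, y) \<in> E ^^ 2" using assms(3,4) by (auto simp: numeral_2_eq_2)
  then have "(INF k\<in>{k. (x, y) \<in> E ^^ k}. enat k) \<le> enat 2"
    by (intro INF_lower) simp
  then show "(INF k\<in>{k. (x, y) \<in> E ^^ k}. enat k) \<le> 2" by (simp add: numeral_eq_enat)
  have "2 \<le> k" if k: "(x, y) \<in> E ^^ k" for k
  proof (rule ccontr)
    assume "\<not> 2 \<le> k"
    then have "k = 0 \<or> k = 1" by linarith
    then show False using k assms(1,2) by auto
  qed
  then show "2 \<le> (INF k\<in>{k. (x, y) \<in> E ^^ k}. enat k)"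
    by (intro INF_greatest) (auto simp: numeral_eq_enat)
qed

lemma HG_common_neighbour:
  assumes "n \<ge> 3" "x \<in> HG_verts n" "y \<in> HG_verts n"
  obtains z where "(x, z) \<in> HG_adj n" "(z, y) \<in> HG_adj n"
proof -
  have "\<exists>c\<in>{1..n}. c \<noteq> a \<and> c \<noteq> b" for a b
  proof (rule ccontr)
    assume "\<not> ?thesis"
    then have "{1..n} \<subseteq> {a, b}" by auto
    then have "card {1..n} \<le> card {a, b}" by (intro card_mono) auto
    also have "\<dots> \<le> 2" by (simp add: card_insert_if)
    finally show False using assms(1) by simp
  qed
  then have "\<forall>i. \<exists>c\<in>{1..n}. c \<noteq> x $ i \<and> c \<noteq> y $ i" by blast
  then obtain f where f: "\<And>i. f i \<in> {1..n} \<and> f i \<noteq> x $ i \<and> f i \<noteq> y $ i" by metis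
  have "(x, \<chi> i. f i) \<in> HG_adj n" "(\<chi> i. f i, y) \<in> HG_adj n"
    using assms(2,3) f unfolding HG_adj_def HG_verts_def by (auto, (metis f)+)
  then show thesis using that by blast
qed

definition trace :: "(nat ^ 3) set \<Rightarrow> nat ^ 3 \<Rightarrow> (nat ^ 3) set" where
  "trace W x = {w \<in> W. \<exists>i. w $ i = x $ i}"

lemma HG_dist:
  assumes "n \<ge> 3" "x \<in> HG_verts n" "w \<in> HG_verts n" "x \<noteq> w"
  shows "graph_dist (HG_adj n) x w = (if \<exists>i. w $ i = x $ i then 2 else 1)"
proof (cases "(x, w) \<in> HG_adj n")
  case True
  then have "\<nexists>i. w $ i = x $ i" unfolding HG_adj_def by auto metis
  then show ?thesis using graph_dist_eq_1[OF assms(4) True] by simp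
next
  case False
  then have "\<exists>i. w $ i = x $ i" using assms(2,3) unfolding HG_adj_def by auto metis
  moreover obtain z where "(x, z) \<in> HG_adj n" "(z, w) \<in> HG_adj n"
    using HG_common_neighbour assms(1-3) .
  ultimately show ?thesis using graph_dist_eq_2[OF assms(4) False] by simp
qed

lemma resolving_set_iff_trace_inj:
  assumes "n \<ge> 3" "W \<subseteq> HG_verts n"
  shows "resolving_set (HG_verts n) (HG_adj n) W \<longleftrightarrow> inj_on (trace W) (HG_verts n - W)"
proof -
  have "(\<exists>w\<in>W. graph_dist (HG_adj n) x w \<noteq> graph_dist (HG_adj n) y w) \<longleftrightarrow> trace W x \<noteq> trace W y"
    if x: "x \<in> HG_verts n - W" and y: "y \<in> HG_verts n - W" for x y
  proof -
    have "graph_dist (HG_adj n) x w = graph_dist (HG_adj n) y w \<longleftrightarrow>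
        (w \<in> trace W x \<longleftrightarrow> w \<in> trace W y)" if w: "w \<in> W" for w
    proof -
      have "x \<noteq> w" "y \<noteq> w" "w \<in> HG_verts n" using x y w assms(2) by auto
      then show ?thesis
        using x y w HG_dist[OF assms(1), of x w] HG_dist[OF assms(1), of y w]
        by (simp add: trace_def one_enat_def numeral_eq_enat)
    qed
    moreover have "trace W x \<subseteq> W" "trace W y \<subseteq> W" by (auto simp: trace_def)
    ultimately show ?thesis by blast
  qed
  then show ?thesis using assms(2) unfolding resolving_set_def inj_on_def by blast
qed

section \<open>Permutations of the three colors\<close>

lemma three_distinct_exhaust:
  fixes i j k l :: 3
  assumes "distinct [i, j, k]"
  shows "l = i \<or> l = j \<or> l = k"
  using assms exhaust_3[of i] exhaust_3[of j] exhaust_3[of k] exhaust_3[of l] by auto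

lemma ex_three_distinct:
  fixes i j k :: 3
  assumes "distinct [i, j, k]"
  shows "(\<exists>l. P l) \<longleftrightarrow> P i \<or> P j \<or> P k"
  using three_distinct_exhaust[OF assms] by metis

lemma three_cases:
  fixes P :: "3 \<Rightarrow> bool"
  obtains (none) "\<forall>l. \<not> P l"
  | (one) i j k where "distinct [i, j, k]" "P i" "\<not> P j" "\<not> P k"
  | (two) i j k where "distinct [i, j, k]" "P i" "P j" "\<not> P k"
  | (all) "\<forall>l. P l"
proof -
  have "distinct [1, 2, 3::3]" "distinct [2, 1, 3::3]" "distinct [3, 1, 2::3]"
    "distinct [1, 3, 2::3]" "distinct [2, 3, 1::3]" by auto
  then show thesis
    by (cases "P 1"; cases "P 2"; cases "P 3") (metis exhaust_3 none one two all)+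
qed

section \<open>Landmark systems as properly edge-colored graphs\<close>

text \<open>
  Below, landmarks that agree in coordinate \<open>i\<close> are thought of as the ends of an edge of color \<open>i\<close>;
  this turns the combinatorics of hyperedges into equations between coordinates.
\<close>

locale landmark_system =
  fixes n :: nat and W :: "(nat ^ 3) set"
  assumes basic: "two_basic_landmark_system n W"
begin

lemma subset_verts: "W \<subseteq> HG_verts n"
  using basic by (simp add: two_basic_landmark_system_def)

lemma coord_range: "w \<in> W \<Longrightarrow> w $ i \<in> {1..n}"
  using subset_verts by (auto simp: HG_verts_def)

lemma edge_obtain:
  assumes "a \<in> {1..n}"
  obtains p q where "slice W i a = {p, q}" "p \<noteq> q" "p \<in> W" "q \<in> W" "p $ i = a" "q $ i = a"
proof -
  have "card (slice W i a) = 2" using basic assms by (auto simp: two_basic_landmark_system_def)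
  then obtain p q where pq: "slice W i a = {p, q}" "p \<noteq> q" by (auto simp: card_2_iff)
  then have "p \<in> slice W i a" "q \<in> slice W i a" by auto
  then show thesis using that pq by (auto simp: slice_def)
qed

lemma slice_eq:
  assumes "p \<in> W" "q \<in> W" "p \<noteq> q" "p $ i = q $ i"
  shows "slice W i (p $ i) = {p, q}"
proof -
  obtain r s where "slice W i (p $ i) = {r, s}"
    using edge_obtain coord_range assms(1) by metis
  moreover have "p \<in> slice W i (p $ i)" "q \<in> slice W i (p $ i)"
    using assms by (auto simp: slice_def)
  ultimately show ?thesis using assms(3) by auto
qed

lemma same_coord_iff:
  assumes "p \<in> W" "q \<in> W" "p \<noteq> q" "p $ i = q $ i" "w \<in> W"
  shows "w $ i = p $ i \<longleftrightarrow> w = p \<or> w = q"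
  using slice_eq[OF assms(1-4)] assms(5) by (auto simp: slice_def)

lemma eq_if_two_coords_eq:
  assumes "p \<in> W" "q \<in> W" "i \<noteq> j" "p $ i = q $ i" "p $ j = q $ j"
  shows "p = q"
proof (rule ccontr)
  assume "p \<noteq> q"
  then have "slice W i (p $ i) \<inter> slice W j (p $ j) = {p, q}"
    using slice_eq assms by simp
  moreover have "card (slice W i (p $ i) \<inter> slice W j (p $ j)) \<le> 1"
    using basic coord_range[OF assms(1)] assms(3) by (simp add: two_basic_landmark_system_def)
  ultimately show False using \<open>p \<noteq> q\<close> by simp
qed

lemma hedge_iff:
  assumes "p \<noteq> q"
  shows "(i, {p, q}) \<in> hedges (landmark_graph n W) \<longleftrightarrow> p \<in> W \<and> q \<in> W \<and> p $ i = q $ i"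
proof
  assume "(i, {p, q}) \<in> hedges (landmark_graph n W)"
  then obtain a where "{p, q} = slice W i a" by (auto simp: landmark_graph_def)
  then have "p \<in> slice W i a" "q \<in> slice W i a" by auto
  then show "p \<in> W \<and> q \<in> W \<and> p $ i = q $ i" by (auto simp: slice_def)
next
  assume "p \<in> W \<and> q \<in> W \<and> p $ i = q $ i"
  then show "(i, {p, q}) \<in> hedges (landmark_graph n W)"
    using slice_eq[of p q i] assms coord_range[of p i] by (force simp: landmark_graph_def)
qed

lemma colored_cycle_iff:
  "colored_cycle (landmark_graph n W) vs cs \<longleftrightarrow>
     length vs \<ge> 3 \<and> length cs = length vs \<and> distinct vs \<and> set vs \<subseteq> W \<and>
     (\<forall>k<length vs. (vs ! k) $ (cs ! k) = (vs ! (Suc k mod length vs)) $ (cs ! k))"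
  (is "?L \<longleftrightarrow> ?R")
proof -
  have edge: "(cs ! k, {vs ! k, vs ! (Suc k mod length vs)}) \<in> hedges (landmark_graph n W) \<longleftrightarrow>
      (vs ! k) $ (cs ! k) = (vs ! (Suc k mod length vs)) $ (cs ! k)"
    if "length vs \<ge> 3" "distinct vs" "set vs \<subseteq> W" "k < length vs" for k
  proof -
    have "Suc k mod length vs < length vs" using that(4) by (intro mod_less_divisor) linarith
    moreover have "Suc k mod length vs \<noteq> k" using that(1,4) by (cases "Suc k = length vs") auto
    ultimately have "vs ! k \<noteq> vs ! (Suc k mod length vs)"
      using that by (simp add: nth_eq_iff_index_eq)
    moreover have "vs ! k \<in> W" "vs ! (Suc k mod length vs) \<in> W"
      using that nth_mem \<open>Suc k mod length vs < length vs\<close> by blast+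
    ultimately show ?thesis using hedge_iff by simp
  qed
  have "hverts (landmark_graph n W) = W" by (simp add: landmark_graph_def)
  then show ?thesis
    unfolding colored_cycle_def
    by (simp only:) (intro conj_cong refl all_cong1 imp_cong edge)
qed

lemma colored_4_cycle_iff:
  "colored_cycle (landmark_graph n W) [p, q, r, s] [a, b, c, d] \<longleftrightarrow>
     {p, q, r, s} \<subseteq> W \<and> distinct [p, q, r, s] \<and>
     p $ a = q $ a \<and> q $ b = r $ b \<and> r $ c = s $ c \<and> s $ d = p $ d"
  unfolding colored_cycle_iff by (simp add: All_less_Suc) blast

lemma colored_6_cycle_iff:
  "colored_cycle (landmark_graph n W) [v0, v1, v2, v3, v4, v5] [a, b, c, d, e, f] \<longleftrightarrow>
     {v0, v1, v2, v3, v4, v5} \<subseteq> W \<and> distinct [v0, v1, v2, v3, v4, v5] \<and>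
     v0 $ a = v1 $ a \<and> v1 $ b = v2 $ b \<and> v2 $ c = v3 $ c \<and>
     v3 $ d = v4 $ d \<and> v4 $ e = v5 $ e \<and> v5 $ f = v0 $ f"
  unfolding colored_cycle_iff by (simp add: All_less_Suc) blast

text \<open>
  The coloring is proper because an edge has only two ends.
\<close>

lemma consecutive_colors_differ:
  assumes "{p, q, r} \<subseteq> W" "distinct [p, q, r]" "p $ i = q $ i" "q $ j = r $ j"
  shows "i \<noteq> j"
proof
  assume "i = j"
  then have "r = p \<or> r = q" using same_coord_iff[of p q i r] assms by simp
  then show False using assms(2) by auto
qed

lemma three_colored_4_cycleI:
  fixes i j k :: 3
  assumes ijk: "distinct [i, j, k]"
    and "{p, q, r, s} \<subseteq> W" "distinct [p, q, r, s]"
    and "p $ i = q $ i" "q $ j = r $ j" "r $ i = s $ i" "s $ k = p $ k"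
  shows "has_three_colored_4_cycle (landmark_graph n W)"
proof -
  have "colored_cycle (landmark_graph n W) [p, q, r, s] [i, j, i, k]"
    unfolding colored_4_cycle_iff using assms by blast
  moreover have "set [i, j, i, k] = {1, 2, 3}"
    using ijk three_distinct_exhaust[OF ijk] exhaust_3 by auto
  ultimately show ?thesis unfolding has_three_colored_4_cycle_def
    by (intro exI[of _ "[p, q, r, s]"] exI[of _ "[i, j, i, k]"]) simp
qed

lemma three_colored_4_cycleE:
  assumes "has_three_colored_4_cycle (landmark_graph n W)"
  obtains i j k :: 3 and p q r s where "distinct [i, j, k]"
    "{p, q, r, s} \<subseteq> W" "distinct [p, q, r, s]"
    "p $ i = q $ i" "q $ j = r $ j" "r $ i = s $ i" "s $ k = p $ k"
proof -
  obtain vs cs where cyc: "colored_cycle (landmark_graph n W) vs cs"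
    and len: "length vs = 4" and cs: "set cs = {1, 2, 3}"
    using assms by (auto simp: has_three_colored_4_cycle_def)
  have "length cs = 4" using cyc len by (simp add: colored_cycle_def)
  obtain p q r s where vs_eq: "vs = [p, q, r, s]"
    using len by (auto simp: numeral_eq_Suc length_Suc_conv)
  obtain a b c d where cs_eq: "cs = [a, b, c, d]"
    using \<open>length cs = 4\<close> by (auto simp: numeral_eq_Suc length_Suc_conv)
  have vs: "{p, q, r, s} \<subseteq> W" "distinct [p, q, r, s]"
    and edges: "p $ a = q $ a" "q $ b = r $ b" "r $ c = s $ c" "s $ d = p $ d"
    using cyc unfolding colored_4_cycle_iff vs_eq cs_eq by blast+
  have ab: "a \<noteq> b" by (rule consecutive_colors_differ[OF _ _ edges(1,2)]) (use vs in auto)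
  have bc: "b \<noteq> c" by (rule consecutive_colors_differ[OF _ _ edges(2,3)]) (use vs in auto)
  have cd: "c \<noteq> d" by (rule consecutive_colors_differ[OF _ _ edges(3,4)]) (use vs in auto)
  have da: "d \<noteq> a" by (rule consecutive_colors_differ[OF _ _ edges(4,1)]) (use vs in auto)
  have set_cs: "{1, 2, 3} = {a, b, c, d}" using cs cs_eq by auto
  \<comment> \<open>Four pairwise different colors are impossible; the repeated color sits on opposite edges.\<close>
  have "a = c \<or> b = d"
    using ab bc cd da exhaust_3[of a] exhaust_3[of b] exhaust_3[of c] exhaust_3[of d] by auto
  moreover have "\<not> (a = c \<and> b = d)"
  proof
    assume "a = c \<and> b = d"
    then have "card {1, 2, 3::3} \<le> 2" unfolding set_cs by (simp add: card_insert_if)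
    then show False by simp
  qed
  ultimately consider "a = c" "distinct [a, b, d]" | "b = d" "distinct [b, c, a]"
    using ab bc cd da by auto
  then show thesis
  proof cases
    case 1
    then show thesis using that[OF 1(2) vs] edges by simp
  next
    case 2
    have "{q, r, s, p} \<subseteq> W" "distinct [q, r, s, p]" using vs by auto
    from that[OF 2(2) this] show thesis using edges 2(1) by simp
  qed
qed

lemma opposite_colored_6_cycleI:
  fixes i j k :: 3
  assumes "{v0, v1, v2, v3, v4, v5} \<subseteq> W" "distinct [v0, v1, v2, v3, v4, v5]"
    and "v0 $ i = v1 $ i" "v1 $ j = v2 $ j" "v2 $ k = v3 $ k"
    and "v3 $ i = v4 $ i" "v4 $ j = v5 $ j" "v5 $ k = v0 $ k"
  shows "has_opposite_colored_6_cycle (landmark_graph n W)"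
proof -
  have "colored_cycle (landmark_graph n W) [v0, v1, v2, v3, v4, v5] [i, j, k, i, j, k]"
    unfolding colored_6_cycle_iff using assms by blast
  moreover have "\<forall>l<3. [i, j, k, i, j, k] ! l = [i, j, k, i, j, k] ! (l + 3)"
    by (auto simp: numeral_eq_Suc less_Suc_eq)
  ultimately show ?thesis unfolding has_opposite_colored_6_cycle_def
    by (intro exI[of _ "[v0, v1, v2, v3, v4, v5]"] exI[of _ "[i, j, k, i, j, k]"]) simp
qed

lemma opposite_colored_6_cycleE:
  assumes "has_opposite_colored_6_cycle (landmark_graph n W)"
  obtains i j k :: 3 and v0 v1 v2 v3 v4 v5 where "distinct [i, j, k]"
    "{v0, v1, v2, v3, v4, v5} \<subseteq> W" "distinct [v0, v1, v2, v3, v4, v5]"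
    "v0 $ i = v1 $ i" "v1 $ j = v2 $ j" "v2 $ k = v3 $ k"
    "v3 $ i = v4 $ i" "v4 $ j = v5 $ j" "v5 $ k = v0 $ k"
proof -
  obtain vs cs where cyc: "colored_cycle (landmark_graph n W) vs cs"
    and len: "length vs = 6" and cs: "\<forall>k<3. cs ! k = cs ! (k + 3)"
    using assms by (auto simp: has_opposite_colored_6_cycle_def)
  have "length cs = 6" using cyc len by (simp add: colored_cycle_def)
  obtain v0 v1 v2 v3 v4 v5 where vs_eq: "vs = [v0, v1, v2, v3, v4, v5]"
    using len by (auto simp: numeral_eq_Suc length_Suc_conv)
  obtain i j k i' j' k' where cs_eq': "cs = [i, j, k, i', j', k']"
    using \<open>length cs = 6\<close> by (auto simp: numeral_eq_Suc length_Suc_conv)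
  have "i' = i" "j' = j" "k' = k"
    using cs[rule_format, of 0] cs[rule_format, of 1] cs[rule_format, of 2]
    by (auto simp: cs_eq' numeral_eq_Suc)
  then have cs_eq: "cs = [i, j, k, i, j, k]" using cs_eq' by simp
  have vs: "{v0, v1, v2, v3, v4, v5} \<subseteq> W" "distinct [v0, v1, v2, v3, v4, v5]"
    and edges: "v0 $ i = v1 $ i" "v1 $ j = v2 $ j" "v2 $ k = v3 $ k"
    "v3 $ i = v4 $ i" "v4 $ j = v5 $ j" "v5 $ k = v0 $ k"
    using cyc unfolding colored_6_cycle_iff vs_eq cs_eq by blast+
  have ij: "i \<noteq> j" by (rule consecutive_colors_differ[OF _ _ edges(1,2)]) (use vs in auto)
  have jk: "j \<noteq> k" by (rule consecutive_colors_differ[OF _ _ edges(2,3)]) (use vs in auto)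
  have ki: "k \<noteq> i" by (rule consecutive_colors_differ[OF _ _ edges(3,4)]) (use vs in auto)
  have "distinct [i, j, k]" using ij jk ki by auto
  from that[OF this vs edges] show thesis .
qed

section \<open>Forbidden cycles give equal traces\<close>

text \<open>
  One edge of each color prescribes the three coordinates of a vertex, whose trace is then the union
  of the edges. This vertex can only be a landmark if all three edges meet in it, which disjointness
  of two of them excludes.
\<close>

lemma edge_triple_vertex:
  fixes i j k :: 3
  assumes ijk: "distinct [i, j, k]"
    and W: "{p, p', q, q', r, r'} \<subseteq> W"
    and p: "p \<noteq> p'" "p $ i = p' $ i"
    and q: "q \<noteq> q'" "q $ j = q' $ j"
    and r: "r \<noteq> r'" "r $ k = r' $ k"
    and disj: "{q, q'} \<inter> {r, r'} = {}"
  shows "\<exists>x \<in> HG_verts n - W. x $ i = p $ i \<and> trace W x = {p, p', q, q', r, r'}"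
proof -
  define x :: "nat ^ 3" where
    "x = (\<chi> l. if l = i then p $ i else if l = j then q $ j else r $ k)"
  have x: "x $ i = p $ i" "x $ j = q $ j" "x $ k = r $ k"
    using ijk by (auto simp: x_def)
  have all3: "(\<exists>l. w $ l = x $ l) \<longleftrightarrow> w $ i = p $ i \<or> w $ j = q $ j \<or> w $ k = r $ k" for w :: "nat ^ 3"
    using ex_three_distinct[OF ijk, of "\<lambda>l. w $ l = x $ l"] x by simp
  have mem: "p \<in> W" "p' \<in> W" "q \<in> W" "q' \<in> W" "r \<in> W" "r' \<in> W" using W by auto
  note iffs = same_coord_iff[OF mem(1,2) p] same_coord_iff[OF mem(3,4) q]
    same_coord_iff[OF mem(5,6) r]
  have "w \<in> trace W x \<longleftrightarrow> w \<in> {p, p', q, q', r, r'}" for w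
  proof (cases "w \<in> W")
    case True
    then show ?thesis unfolding trace_def mem_Collect_eq all3 iffs[OF True] by simp
  next
    case False
    then show ?thesis using mem by (auto simp: trace_def)
  qed
  then have "trace W x = {p, p', q, q', r, r'}" by blast
  moreover have "x \<notin> W"
  proof
    assume "x \<in> W"
    then have "x \<in> {q, q'} \<inter> {r, r'}" using iffs(2,3)[of x] x(2,3) by simp
    then show False using disj by simp
  qed
  moreover have "x \<in> HG_verts n"
    using coord_range W by (auto simp: HG_verts_def x_def)
  ultimately show ?thesis using x(1) by blast
qed

lemma trace_not_inj_if_4_cycle:
  fixes i j k :: 3
  assumes ijk: "distinct [i, j, k]"
    and W: "{p, q, r, s} \<subseteq> W" and "distinct [p, q, r, s]"
    and "p $ i = q $ i" "q $ j = r $ j" "r $ i = s $ i" "s $ k = p $ k"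
  shows "\<not> inj_on (trace W) (HG_verts n - W)"
proof
  assume inj: "inj_on (trace W) (HG_verts n - W)"
  have "\<exists>x \<in> HG_verts n - W. x $ i = p $ i \<and> trace W x = {p, q, q, r, s, p}"
    by (rule edge_triple_vertex) (use assms in auto)
  then obtain x where x: "x \<in> HG_verts n - W" "x $ i = p $ i" "trace W x = {p, q, q, r, s, p}"
    by blast
  have "\<exists>y \<in> HG_verts n - W. y $ i = r $ i \<and> trace W y = {r, s, q, r, s, p}"
    by (rule edge_triple_vertex) (use assms in auto)
  then obtain y where y: "y \<in> HG_verts n - W" "y $ i = r $ i" "trace W y = {r, s, q, r, s, p}"
    by blast
  have "trace W x = trace W y" using x(3) y(3) by auto
  then have "x = y" using inj x(1) y(1) by (auto dest: inj_onD)
  then have "r $ i = p $ i" using x(2) y(2) by simp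
  then have "r = p \<or> r = q" using same_coord_iff[of p q i r] assms(2-4) by simp
  then show False using assms(3) by auto
qed

lemma trace_not_inj_if_6_cycle:
  fixes i j k :: 3
  assumes ijk: "distinct [i, j, k]"
    and W: "{v0, v1, v2, v3, v4, v5} \<subseteq> W" and "distinct [v0, v1, v2, v3, v4, v5]"
    and "v0 $ i = v1 $ i" "v1 $ j = v2 $ j" "v2 $ k = v3 $ k"
    and "v3 $ i = v4 $ i" "v4 $ j = v5 $ j" "v5 $ k = v0 $ k"
  shows "\<not> inj_on (trace W) (HG_verts n - W)"
proof
  assume inj: "inj_on (trace W) (HG_verts n - W)"
  have "\<exists>x \<in> HG_verts n - W. x $ i = v0 $ i \<and> trace W x = {v0, v1, v4, v5, v2, v3}"
    by (rule edge_triple_vertex) (use assms in auto)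
  then obtain x where x: "x \<in> HG_verts n - W" "x $ i = v0 $ i" "trace W x = {v0, v1, v4, v5, v2, v3}"
    by blast
  have "\<exists>y \<in> HG_verts n - W. y $ i = v3 $ i \<and> trace W y = {v3, v4, v1, v2, v5, v0}"
    by (rule edge_triple_vertex) (use assms in auto)
  then obtain y where y: "y \<in> HG_verts n - W" "y $ i = v3 $ i" "trace W y = {v3, v4, v1, v2, v5, v0}"
    by blast
  have "trace W x = trace W y" using x(3) y(3) by auto
  then have "x = y" using inj x(1) y(1) by (auto dest: inj_onD)
  then have "v3 $ i = v0 $ i" using x(2) y(2) by simp
  then have "v3 = v0 \<or> v3 = v1" using same_coord_iff[of v0 v1 i v3] assms(2-4) by simp
  then show False using assms(3) by auto
qed

section \<open>Equal traces give forbidden cycles\<close>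

text \<open>
  The two ends of the edge cannot lie on the same covering edge, since edges of different colors
  share at most one vertex; so each covering edge contains exactly one of them.
\<close>

lemma edge_splits:
  fixes i j k :: 3
  assumes "distinct [i, j, k]" "a \<in> {1..n}"
    and cover: "\<And>w. w \<in> W \<Longrightarrow> w $ i = a \<Longrightarrow> w $ j = b \<or> w $ k = c"
  obtains p q where "p \<in> W" "q \<in> W" "p $ i = a" "p $ j = b" "p $ k \<noteq> c"
    "q $ i = a" "q $ k = c" "q $ j \<noteq> b"
proof -
  obtain p q where pq: "p \<noteq> q" "p \<in> W" "q \<in> W" "p $ i = a" "q $ i = a"
    using edge_obtain[OF assms(2)] by metis
  have "\<not> (p $ j = b \<and> q $ j = b)" "\<not> (p $ k = c \<and> q $ k = c)"
    using eq_if_two_coords_eq[of p q i j] eq_if_two_coords_eq[of p q i k] pq assms(1) by auto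
  then consider "p $ j = b" "p $ k \<noteq> c" "q $ k = c" "q $ j \<noteq> b"
    | "q $ j = b" "q $ k \<noteq> c" "p $ k = c" "p $ j \<noteq> b"
    using cover[of p] cover[of q] pq by blast
  then show thesis using that pq by cases blast+
qed

text \<open>
  The \<open>i\<close>-edge of \<open>x\<close> is disjoint from the \<open>i\<close>-edge of \<open>y\<close>, so if the traces agree it is covered by
  the other two edges of \<open>y\<close>.
\<close>

lemma trace_edge_end:
  fixes i j k :: 3
  assumes ijk: "distinct [i, j, k]" and x: "x \<in> HG_verts n"
    and trace: "trace W x = trace W y" and ne: "x $ i \<noteq> y $ i"
  obtains p where "p \<in> W" "p $ i = x $ i" "p $ j = y $ j" "p $ k \<noteq> y $ k"
proof (rule edge_splits[OF ijk])
  show "x $ i \<in> {1..n}" using x by (simp add: HG_verts_def)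
  show "w $ j = y $ j \<or> w $ k = y $ k" if "w \<in> W" "w $ i = x $ i" for w
  proof -
    have "w \<in> trace W y" using that trace by (auto simp: trace_def)
    then show ?thesis
      using that ne ex_three_distinct[OF ijk, of "\<lambda>l. w $ l = y $ l"] by (simp add: trace_def)
  qed
qed (use that in blast)

lemma cycle_4_if_differ_in_one:
  fixes i j k :: 3
  assumes ijk: "distinct [i, j, k]" and x: "x \<in> HG_verts n" and y: "y \<in> HG_verts n"
    and trace: "trace W x = trace W y"
    and ne: "x $ i \<noteq> y $ i" and eq: "x $ j = y $ j" "x $ k = y $ k"
  shows "has_three_colored_4_cycle (landmark_graph n W)"
proof -
  have ikj: "distinct [i, k, j]" using ijk by auto
  obtain p where p: "p \<in> W" "p $ i = x $ i" "p $ j = y $ j" "p $ k \<noteq> y $ k"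
    using trace_edge_end[OF ijk x trace ne] .
  obtain q where q: "q \<in> W" "q $ i = x $ i" "q $ k = y $ k" "q $ j \<noteq> y $ j"
    using trace_edge_end[OF ikj x trace ne] .
  obtain r where r: "r \<in> W" "r $ i = y $ i" "r $ j = x $ j" "r $ k \<noteq> x $ k"
    using trace_edge_end[OF ijk y trace[symmetric] ne[symmetric]] .
  obtain s where s: "s \<in> W" "s $ i = y $ i" "s $ k = x $ k" "s $ j \<noteq> x $ j"
    using trace_edge_end[OF ikj y trace[symmetric] ne[symmetric]] .
  have "q \<noteq> p" "q \<noteq> r" "q \<noteq> s" "p \<noteq> r" "p \<noteq> s" "r \<noteq> s"
    using p q r s ne by metis+
  then have "distinct [q, p, r, s]" by simp
  then show ?thesis
    by (rule three_colored_4_cycleI[OF ijk, rotated]) (use p q r s eq in simp_all)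
qed

text \<open>
  The ends of the common edge of color \<open>k\<close> lie one on each of the two edges of color \<open>i\<close>. The
  \<open>j\<close>-edge of \<open>x\<close> has an end on the common edge which is off the \<open>i\<close>-edge of \<open>y\<close>. That end is therefore
  on the \<open>i\<close>-edge of \<open>x\<close>, so the three edges of \<open>x\<close> meet there and \<open>x\<close> is a landmark.
\<close>

lemma not_differ_in_two:
  fixes i j k :: 3
  assumes ijk: "distinct [i, j, k]" and x: "x \<in> HG_verts n - W" and y: "y \<in> HG_verts n"
    and trace: "trace W x = trace W y"
    and ne: "x $ i \<noteq> y $ i" "x $ j \<noteq> y $ j" and eq: "x $ k = y $ k"
  shows False
proof -
  have ikj: "distinct [i, k, j]" and jki: "distinct [j, k, i]" using ijk by auto
  have xV: "x \<in> HG_verts n" using x by simp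
  obtain q1 where q1: "q1 \<in> W" "q1 $ i = x $ i" "q1 $ k = y $ k" "q1 $ j \<noteq> y $ j"
    using trace_edge_end[OF ikj xV trace ne(1)] .
  obtain q2 where q2: "q2 \<in> W" "q2 $ i = y $ i" "q2 $ k = x $ k" "q2 $ j \<noteq> x $ j"
    using trace_edge_end[OF ikj y trace[symmetric] ne(1)[symmetric]] .
  obtain q3 where q3: "q3 \<in> W" "q3 $ j = x $ j" "q3 $ k = y $ k" "q3 $ i \<noteq> y $ i"
    using trace_edge_end[OF jki xV trace ne(2)] .
  have "q1 \<noteq> q2" using q1 q2 ne by auto
  then have "q3 = q1 \<or> q3 = q2" using same_coord_iff[of q1 q2 k q3] q1 q2 q3 eq by simp
  then have "q3 = q1" using q2 q3 by auto
  then have "q1 $ l = x $ l" for l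
    using three_distinct_exhaust[OF ijk, of l] q1(2,3) q3(2) eq by (elim disjE) simp_all
  then have "q1 = x" by (simp add: vec_eq_iff)
  then show False using q1 x by auto
qed

lemma cycle_6_if_differ_in_all:
  assumes x: "x \<in> HG_verts n" and y: "y \<in> HG_verts n"
    and trace: "trace W x = trace W y" and ne: "\<And>l. x $ l \<noteq> y $ l"
  shows "has_opposite_colored_6_cycle (landmark_graph n W)"
proof -
  have perms: "distinct [1, 2, 3::3]" "distinct [1, 3, 2::3]" "distinct [2, 1, 3::3]"
    "distinct [2, 3, 1::3]" "distinct [3, 1, 2::3]" "distinct [3, 2, 1::3]" by auto
  note end_x = trace_edge_end[OF _ x trace ne]
  note end_y = trace_edge_end[OF _ y trace[symmetric] ne[symmetric]]
  obtain p1 where p1: "p1 \<in> W" "p1 $ 1 = x $ 1" "p1 $ 2 = y $ 2" "p1 $ 3 \<noteq> y $ 3"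
    using end_x[OF perms(1)] .
  obtain q1 where q1: "q1 \<in> W" "q1 $ 1 = x $ 1" "q1 $ 3 = y $ 3" "q1 $ 2 \<noteq> y $ 2"
    using end_x[OF perms(2)] .
  obtain p2 where p2: "p2 \<in> W" "p2 $ 2 = x $ 2" "p2 $ 1 = y $ 1" "p2 $ 3 \<noteq> y $ 3"
    using end_x[OF perms(3)] .
  obtain q2 where q2: "q2 \<in> W" "q2 $ 2 = x $ 2" "q2 $ 3 = y $ 3" "q2 $ 1 \<noteq> y $ 1"
    using end_x[OF perms(4)] .
  obtain p3 where p3: "p3 \<in> W" "p3 $ 3 = x $ 3" "p3 $ 1 = y $ 1" "p3 $ 2 \<noteq> y $ 2"
    using end_x[OF perms(5)] .
  obtain q3 where q3: "q3 \<in> W" "q3 $ 3 = x $ 3" "q3 $ 2 = y $ 2" "q3 $ 1 \<noteq> y $ 1"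
    using end_x[OF perms(6)] .
  \<comment> \<open>The cycle is \<open>p1, q1, q2, p2, p3, q3\<close>.\<close>
  note ends = p1 q1 p2 q2 p3 q3
  \<comment> \<open>The edges of \<open>y\<close> join \<open>p2\<close> to \<open>p3\<close>, \<open>p1\<close> to \<open>q3\<close> and \<open>q1\<close> to \<open>q2\<close>. Two such ends are different
    because splitting the edge of \<open>y\<close> gives an end on the first vertex's edge of \<open>x\<close> only, and that
    end must be the first vertex.\<close>
  have p2p3: "p2 \<noteq> p3"
  proof -
    obtain u where u: "u \<in> W" "u $ 1 = y $ 1" "u $ 2 = x $ 2" "u $ 3 \<noteq> x $ 3"
      using end_y[OF perms(1)] .
    have "u = p2" by (rule eq_if_two_coords_eq[of u p2 1 2]) (simp_all add: u p2)
    then show ?thesis using u(4) p3(2) by auto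
  qed
  have p1q3: "p1 \<noteq> q3"
  proof -
    obtain u where u: "u \<in> W" "u $ 2 = y $ 2" "u $ 1 = x $ 1" "u $ 3 \<noteq> x $ 3"
      using end_y[OF perms(3)] .
    have "u = p1" by (rule eq_if_two_coords_eq[of u p1 2 1]) (simp_all add: u p1)
    then show ?thesis using u(4) q3(2) by auto
  qed
  have q1q2: "q1 \<noteq> q2"
  proof -
    obtain u where u: "u \<in> W" "u $ 3 = y $ 3" "u $ 1 = x $ 1" "u $ 2 \<noteq> x $ 2"
      using end_y[OF perms(5)] .
    have "u = q1" by (rule eq_if_two_coords_eq[of u q1 3 1]) (simp_all add: u q1)
    then show ?thesis using u(4) q2(2) by auto
  qed
  have "distinct [p1, q1, q2, p2, p3, q3]"
    using ends ne p2p3 p1q3 q1q2 by (simp, metis)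
  then show ?thesis
    by (rule opposite_colored_6_cycleI[of _ _ _ _ _ _ 1 3 2, rotated]) (use ends in simp_all)
qed

section \<open>The characterization\<close>

lemma trace_inj_iff:
  "inj_on (trace W) (HG_verts n - W) \<longleftrightarrow>
     \<not> has_three_colored_4_cycle (landmark_graph n W) \<and>
     \<not> has_opposite_colored_6_cycle (landmark_graph n W)"
proof
  assume inj: "inj_on (trace W) (HG_verts n - W)"
  show "\<not> has_three_colored_4_cycle (landmark_graph n W) \<and>
      \<not> has_opposite_colored_6_cycle (landmark_graph n W)"
  proof (intro conjI notI)
    assume "has_three_colored_4_cycle (landmark_graph n W)"
    then show False by (rule three_colored_4_cycleE) (rule notE[OF trace_not_inj_if_4_cycle inj])
  next
    assume "has_opposite_colored_6_cycle (landmark_graph n W)"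
    then show False by (rule opposite_colored_6_cycleE) (rule notE[OF trace_not_inj_if_6_cycle inj])
  qed
next
  assume no_cycle: "\<not> has_three_colored_4_cycle (landmark_graph n W) \<and>
      \<not> has_opposite_colored_6_cycle (landmark_graph n W)"
  show "inj_on (trace W) (HG_verts n - W)"
  proof (rule inj_onI)
    fix x y assume x: "x \<in> HG_verts n - W" and y: "y \<in> HG_verts n - W"
      and trace: "trace W x = trace W y"
    have V: "x \<in> HG_verts n" "y \<in> HG_verts n" using x y by auto
    show "x = y"
    proof (cases rule: three_cases[of "\<lambda>l. x $ l \<noteq> y $ l"])
      case none
      then show ?thesis by (simp add: vec_eq_iff)
    next
      case (one i j k)
      then show ?thesis using cycle_4_if_differ_in_one[of i j k x y] V trace no_cycle by auto
    next
      case (two i j k)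
      then show ?thesis using not_differ_in_two[of i j k x y] x V trace by auto
    next
      case all
      then show ?thesis using cycle_6_if_differ_in_all[of x y] V trace no_cycle by auto
    qed
  qed
qed

end

theorem theorem3p7:
  fixes n :: nat and W :: "(nat ^ 3) set"
  assumes "n \<ge> 3"
    and "two_basic_landmark_system n W"
  shows "resolving_set (HG_verts n) (HG_adj n) W \<longleftrightarrow>
           \<not> has_three_colored_4_cycle (landmark_graph n W) \<and>
           \<not> has_opposite_colored_6_cycle (landmark_graph n W)"
proof -
  interpret landmark_system n W using assms(2) by unfold_locales
  show ?thesis
    using resolving_set_iff_trace_inj[OF assms(1) subset_verts] trace_inj_iff by simp
qed

end
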